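(* If ${\sf AR}_{\sf par}\vdash A\rhd B$, then for every ${\sf AR}_{\sf par}$-model $\mathcal{K}$ with $\mathcal{K}\Vdash A$ we have $\mathcal{K}\Vdash B$.
   Context: Language: $\wedge,\vee,\to,\bot$ over finite atoms ${\sf atom}={\sf var}\cup{\sf par}$ (disjoint variables and parameters); $\vdash$ is ${\sf IPC}$-derivability. The system ${\sf AR}_{\sf par}$ derives statements $A\rhd B$ ($A,B$ formulas) from: axiom Ax: $A\rhd B$ whenever $\vdash A\to B$; axiom ${\sf V}$: $(B\to C)\rhd\bigvee_{i=1}^{n+m}B[E_i]$ where $B=\bigwedge_{i=1}^n(E_i\to F_i)$, $C=\bigvee_{i=n+1}^{n+m}E_i$, and $B[E]:=E$ if $E\in{\sf par}\cup\{\bot\}$, $B[E]:=B\to E$ otherwise; rules Conj (from $A\rhd B$ and $A\rhd C$ infer $A\rhd B\wedge C$), Cut (from $A\rhd B$, $B\rhd C$ infer $A\rhd C$), Disj (from $B\rhd A$, $C\rhd A$ infer $B\vee C\rhd A$), and Mont$({\sf par})$ (from $A\rhd B$ infer $(p\to A)\rhd(p\to B)$ for $p\in{\sf par}$). General Kripke models: $\mathcal{K}=(W,\prec,V)$ with $\prec$ a strict partial order (possibly infinite, not necessarily a tree), persistent valuation, usual forcing; $\mathcal{K}\Vdash A$ means $A$ is forced at every node. For nodes $v,w$: $v\equiv_{\sf par}w$ iff they force the same parameters. For $W'\subseteq W$, $w\preccurlyeq W'$ means $w\preccurlyeq w'$ for all $w'\in W'$. $w$ is a tight predecessor of $W'$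 if $w\preccurlyeq W'$ and every $u\succcurlyeq w$ either equals $w$ or satisfies $u\succcurlyeq v$ for some $v\in W'$. $w$ is a base if for every finite $W'\subseteq W$ with $w\preccurlyeq W'$ there is $w'$ with $w\preccurlyeq w'\preccurlyeq W'$, $w\equiv_{\sf par}w'$ and $w'$ a tight predecessor of $W'$. $\mathcal{K}$ is an ${\sf AR}_{\sf par}$-model if it has a root $w_0$ and a set $W_b\subseteq W$ (a base-set) with $w_0\in W_b$, every element of $W_b$ a base, and for every $w'\in W_b$ and $w\succcurlyeq w'$ some $v\in W_b$ with $v\equiv_{\sf par}w$ and $w'\preccurlyeq v\preccurlyeq w$. *)

theory Defs
  imports Main
begin

datatype (atoms: 'a) form =
    Bot ("\<^bold>\<bottom>")
  | Atom 'a
  | And "'a form" "'a form" (infixr "\<^bold>\<and>" 75)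
  | Or "'a form" "'a form" (infixr "\<^bold>\<or>" 70)
  | Imp "'a form" "'a form" (infixr "\<^bold>\<rightarrow>" 65)

definition lang :: "'a set \<Rightarrow> 'a form set" where
  "lang At = {A. atoms A \<subseteq> At}"

text \<open>The empty conjunction is \<open>\<bottom> \<rightarrow> \<bottom>\<close> (there is no primitive truth constant); the empty
  disjunction is \<open>\<bottom>\<close>.\<close>

fun big_and :: "'a form list \<Rightarrow> 'a form" where
  "big_and [] = \<^bold>\<bottom> \<^bold>\<rightarrow> \<^bold>\<bottom>"
| "big_and [A] = A"
| "big_and (A # B # As) = A \<^bold>\<and> big_and (B # As)"

fun big_or :: "'a form list \<Rightarrow> 'a form" where
  "big_or [] = \<^bold>\<bottom>"
| "big_or [A] = A"
| "big_or (A # B # As) = A \<^bold>\<or> big_or (B # As)"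

inductive IPC_axiom :: "'a form \<Rightarrow> bool" where
  "IPC_axiom (A \<^bold>\<rightarrow> B \<^bold>\<rightarrow> A)"
| "IPC_axiom ((A \<^bold>\<rightarrow> B \<^bold>\<rightarrow> C) \<^bold>\<rightarrow> (A \<^bold>\<rightarrow> B) \<^bold>\<rightarrow> A \<^bold>\<rightarrow> C)"
| "IPC_axiom (A \<^bold>\<and> B \<^bold>\<rightarrow> A)"
| "IPC_axiom (A \<^bold>\<and> B \<^bold>\<rightarrow> B)"
| "IPC_axiom (A \<^bold>\<rightarrow> B \<^bold>\<rightarrow> A \<^bold>\<and> B)"
| "IPC_axiom (A \<^bold>\<rightarrow> A \<^bold>\<or> B)"
| "IPC_axiom (B \<^bold>\<rightarrow> A \<^bold>\<or> B)"
| "IPC_axiom ((A \<^bold>\<rightarrow> C) \<^bold>\<rightarrow> (B \<^bold>\<rightarrow> C) \<^bold>\<rightarrow> A \<^bold>\<or> B \<^bold>\<rightarrow> C)"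
| "IPC_axiom (\<^bold>\<bottom> \<^bold>\<rightarrow> A)"

text \<open>Requiring the axioms to lie in \<open>lang At\<close> keeps every formula of an \<open>IPC\<close>-derivation, and
  hence (with the guards in \<open>AR_V\<close>) of an \<open>AR\<close>-derivation, inside the language.\<close>

inductive IPC :: "'a set \<Rightarrow> 'a form \<Rightarrow> bool" for At where
  IPC_ax: "IPC_axiom A \<Longrightarrow> A \<in> lang At \<Longrightarrow> IPC At A"
| IPC_mp: "IPC At (A \<^bold>\<rightarrow> B) \<Longrightarrow> IPC At A \<Longrightarrow> IPC At B"

text \<open>\<open>bracket par B E\<close> is \<open>B[E]\<close>.\<close>

definition bracket :: "'a set \<Rightarrow> 'a form \<Rightarrow> 'a form \<Rightarrow> 'a form" where
  "bracket par B E = (if E \<in> Atom ` par \<union> {\<^bold>\<bottom>} then E else B \<^bold>\<rightarrow> E)"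

inductive AR :: "'a set \<Rightarrow> 'a set \<Rightarrow> 'a form \<Rightarrow> 'a form \<Rightarrow> bool" for var par where
  AR_Ax: "IPC (var \<union> par) (A \<^bold>\<rightarrow> B) \<Longrightarrow> AR var par A B"
| AR_V: "\<lbrakk>\<And>i. i \<in> {1..n + m} \<Longrightarrow> E i \<in> lang (var \<union> par);
          \<And>i. i \<in> {1..n} \<Longrightarrow> F i \<in> lang (var \<union> par);
          B = big_and (map (\<lambda>i. E i \<^bold>\<rightarrow> F i) [1..<n + 1]);
          C = big_or (map E [n + 1..<n + m + 1])\<rbrakk>
         \<Longrightarrow> AR var par (B \<^bold>\<rightarrow> C) (big_or (map (\<lambda>i. bracket par B (E i)) [1..<n + m + 1]))"
| AR_Conj: "AR var par A B \<Longrightarrow> AR var par A C \<Longrightarrow> AR var par A (B \<^bold>\<and> C)"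
| AR_Cut: "AR var par A B \<Longrightarrow> AR var par B C \<Longrightarrow> AR var par A C"
| AR_Disj: "AR var par B A \<Longrightarrow> AR var par C A \<Longrightarrow> AR var par (B \<^bold>\<or> C) A"
| AR_Mont: "AR var par A B \<Longrightarrow> p \<in> par \<Longrightarrow> AR var par (Atom p \<^bold>\<rightarrow> A) (Atom p \<^bold>\<rightarrow> B)"

record ('w, 'a) kripke =
  worlds :: "'w set"
  prec :: "'w \<Rightarrow> 'w \<Rightarrow> bool"
  val :: "'w \<Rightarrow> 'a set"

definition preceq :: "('w, 'a) kripke \<Rightarrow> 'w \<Rightarrow> 'w \<Rightarrow> bool" where
  "preceq K u v \<longleftrightarrow> u = v \<or> prec K u v"

definition kripke_model :: "'a set \<Rightarrow> ('w, 'a) kripke \<Rightarrow> bool" where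
  "kripke_model At K \<longleftrightarrow>
     irreflp_on (worlds K) (prec K) \<and> transp_on (worlds K) (prec K) \<and>
     (\<forall>w\<in>worlds K. val K w \<subseteq> At) \<and>
     (\<forall>u\<in>worlds K. \<forall>v\<in>worlds K. prec K u v \<longrightarrow> val K u \<subseteq> val K v)"

primrec forces :: "('w, 'a) kripke \<Rightarrow> 'w \<Rightarrow> 'a form \<Rightarrow> bool" where
  "forces K w \<^bold>\<bottom> \<longleftrightarrow> False"
| "forces K w (Atom a) \<longleftrightarrow> a \<in> val K w"
| "forces K w (A \<^bold>\<and> B) \<longleftrightarrow> forces K w A \<and> forces K w B"
| "forces K w (A \<^bold>\<or> B) \<longleftrightarrow> forces K w A \<or> forces K w B"
| "forces K w (A \<^bold>\<rightarrow> B) \<longleftrightarrow>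
     (\<forall>v\<in>worlds K. preceq K w v \<longrightarrow> forces K v A \<longrightarrow> forces K v B)"

definition valid_in :: "('w, 'a) kripke \<Rightarrow> 'a form \<Rightarrow> bool" where
  "valid_in K A \<longleftrightarrow> (\<forall>w\<in>worlds K. forces K w A)"

definition par_equiv :: "'a set \<Rightarrow> ('w, 'a) kripke \<Rightarrow> 'w \<Rightarrow> 'w \<Rightarrow> bool" where
  "par_equiv par K v w \<longleftrightarrow> (\<forall>p\<in>par. forces K v (Atom p) \<longleftrightarrow> forces K w (Atom p))"

definition below :: "('w, 'a) kripke \<Rightarrow> 'w \<Rightarrow> 'w set \<Rightarrow> bool" where
  "below K w W' \<longleftrightarrow> (\<forall>w'\<in>W'. preceq K w w')"

definition tight_predecessor :: "('w, 'a) kripke \<Rightarrow> 'w \<Rightarrow> 'w set \<Rightarrow> bool" where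
  "tight_predecessor K w W' \<longleftrightarrow>
     below K w W' \<and>
     (\<forall>u\<in>worlds K. preceq K w u \<longrightarrow> u = w \<or> (\<exists>v\<in>W'. preceq K v u))"

text \<open>The finite set \<open>W'\<close> may be empty; a tight predecessor of \<open>{}\<close> is a maximal node.\<close>

definition is_base :: "'a set \<Rightarrow> ('w, 'a) kripke \<Rightarrow> 'w \<Rightarrow> bool" where
  "is_base par K w \<longleftrightarrow>
     (\<forall>W'. finite W' \<and> W' \<subseteq> worlds K \<and> below K w W' \<longrightarrow>
        (\<exists>w'\<in>worlds K. preceq K w w' \<and> below K w' W' \<and> par_equiv par K w w' \<and>
           tight_predecessor K w' W'))"

definition AR_model :: "'a set \<Rightarrow> 'a set \<Rightarrow> ('w, 'a) kripke \<Rightarrow> bool" where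
  "AR_model var par K \<longleftrightarrow>
     kripke_model (var \<union> par) K \<and>
     (\<exists>w\<^sub>0\<in>worlds K. \<exists>W\<^sub>b\<subseteq>worlds K.
        (\<forall>w\<in>worlds K. preceq K w\<^sub>0 w) \<and>
        w\<^sub>0 \<in> W\<^sub>b \<and>
        (\<forall>w\<in>W\<^sub>b. is_base par K w) \<and>
        (\<forall>w'\<in>W\<^sub>b. \<forall>w\<in>worlds K. preceq K w' w \<longrightarrow>
           (\<exists>v\<in>W\<^sub>b. par_equiv par K v w \<and> preceq K w' v \<and> preceq K v w)))"

end

(* Forcing is preserved along a derivation at every element of the base-set, and the root is one.
   The rule Mont uses the base-set condition to pull a node forcing p back to a base forcing p.
   For the axiom V, let w be a base refuting every B[E_i]. Choose above w nodes forcing B and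
   refuting E_i, for each i with B[E_i] = (B -> E_i), and a tight predecessor w' of these nodes
   with the parameters of w. Then w' forces no E_i, so by tightness it forces B, but not C. *)

theory Submission
  imports Defs
begin

lemma preceq_refl: "preceq K w w"
  by (simp add: preceq_def)

lemma preceq_trans:
  assumes "kripke_model At K" "u \<in> worlds K" "v \<in> worlds K" "w \<in> worlds K"
    and "preceq K u v" "preceq K v w"
  shows "preceq K u w"
  using assms unfolding preceq_def kripke_model_def by (metis transp_onD)

lemma forces_mono:
  assumes "kripke_model At K"
  shows "\<lbrakk>forces K u A; preceq K u v; u \<in> worlds K; v \<in> worlds K\<rbrakk> \<Longrightarrow> forces K v A"
proof (induction A)
  case (Atom a)
  then show ?case using assms unfolding kripke_model_def preceq_def forces.simps by blast
next
  case (Imp A B)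
  then show ?case using preceq_trans[OF assms] by (metis forces.simps(5))
qed auto

lemma forces_big_and: "forces K w (big_and As) \<longleftrightarrow> (\<forall>A\<in>set As. forces K w A)"
  by (induction As rule: big_and.induct) auto

lemma forces_big_or: "forces K w (big_or As) \<longleftrightarrow> (\<exists>A\<in>set As. forces K w A)"
  by (induction As rule: big_or.induct) auto

lemma IPC_axiom_sound:
  assumes "kripke_model At K" and "IPC_axiom A" and "w \<in> worlds K"
  shows "forces K w A"
proof -
  note mono = forces_mono[OF assms(1)] and trans = preceq_trans[OF assms(1)]
  from assms(2) show ?thesis
  proof cases
    case (1 A B)
    then show ?thesis using mono by auto
  next
    case (2 A B C)
    show ?thesis unfolding 2 forces.simps
      by (meson preceq_refl trans)
  next
    case (5 A B)
    then show ?thesis using mono by auto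
  next
    case (8 A C B)
    show ?thesis unfolding 8 forces.simps
      by (meson trans)
  qed auto
qed

lemma IPC_sound:
  assumes "kripke_model At K" and "IPC At' A" and "w \<in> worlds K"
  shows "forces K w A"
  using assms(2,3)
proof (induction arbitrary: w)
  case (IPC_ax A)
  then show ?case using IPC_axiom_sound[OF assms(1)] by blast
next
  case (IPC_mp A B)
  then show ?case using preceq_refl by (metis forces.simps(5))
qed

text \<open>The axiom V at one base, with index sets in place of lists: \<open>J\<close> for the
  conjuncts of \<open>B\<close>, \<open>L\<close> for the disjuncts of \<open>C\<close>,
  \<open>I\<close> for the bracketed formulas.\<close>

lemma base_forces_V:
  fixes I :: "'i set" and E F :: "'i \<Rightarrow> 'a form"
  assumes K: "kripke_model At K" and w: "w \<in> worlds K" "is_base par K w"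
    and I: "finite I" "J \<subseteq> I" "L \<subseteq> I"
    and B: "\<And>v. forces K v B \<longleftrightarrow> (\<forall>i\<in>J. forces K v (E i \<^bold>\<rightarrow> F i))"
    and C: "\<And>v. forces K v C \<longleftrightarrow> (\<exists>i\<in>L. forces K v (E i))"
    and BC: "forces K w (B \<^bold>\<rightarrow> C)"
  shows "\<exists>i\<in>I. forces K w (bracket par B (E i))"
proof (rule ccontr)
  assume neg: "\<not> ?thesis"
  \<comment> \<open>Outside \<open>N\<close> the formula \<open>E i\<close> is a parameter or
    \<bottom>, so its forcing depends only on the parameters of a node; inside \<open>N\<close> a
    countermodel node is required.\<close>
  define N where "N = {i\<in>I. E i \<notin> Atom ` par \<union> {\<^bold>\<bottom>}}"
  have "\<exists>v\<in>worlds K. preceq K w v \<and> forces K v B \<and> \<not> forces K v (E i)" if "i \<in> N" for i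
    using neg that by (auto simp: N_def bracket_def)
  then obtain f where f: "\<And>i. i \<in> N \<Longrightarrow> f i \<in> worlds K \<and> preceq K w (f i) \<and>
      forces K (f i) B \<and> \<not> forces K (f i) (E i)"
    by metis
  have "finite (f ` N)" "f ` N \<subseteq> worlds K" "below K w (f ` N)"
    using f I(1) by (auto simp: N_def below_def)
  then obtain w' where w': "w' \<in> worlds K" "preceq K w w'" "par_equiv par K w w'"
      "tight_predecessor K w' (f ` N)"
    using w(2) unfolding is_base_def by meson
  have no_E: "\<not> forces K w' (E i)" if "i \<in> I" for i
  proof (cases "i \<in> N")
    case True
    then have "preceq K w' (f i)"
      using w'(4) by (auto simp: tight_predecessor_def below_def)
    then show ?thesis using f[OF True] forces_mono[OF K] w'(1) by blast
  next
    case False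
    then have E: "E i \<in> Atom ` par \<union> {\<^bold>\<bottom>}" using that by (simp add: N_def)
    \<comment> \<open>Here the bracket is \<open>E i\<close> itself, and \<open>w'\<close> forces
      the same parameters as \<open>w\<close>.\<close>
    then have "\<not> forces K w (E i)" using neg that by (auto simp: bracket_def)
    then show ?thesis using E w'(3) by (auto simp: par_equiv_def)
  qed
  have "forces K w' (E j \<^bold>\<rightarrow> F j)" if j: "j \<in> J" for j
    unfolding forces.simps
  proof (intro ballI impI)
    fix u assume u: "u \<in> worlds K" "preceq K w' u" "forces K u (E j)"
    \<comment> \<open>Being distinct from \<open>w'\<close>, the node \<open>u\<close> lies above
      some \<open>f i\<close> by tightness, and so inherits \<open>B\<close> from it.\<close>
    then have "u \<noteq> w'" using no_E j I(2) by blast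
    then obtain i where "i \<in> N" "preceq K (f i) u"
      using w'(4) u unfolding tight_predecessor_def by blast
    then have "forces K u B" using f forces_mono[OF K] u(1) by blast
    then show "forces K u (F j)" using B j u(1,3) preceq_refl by (metis forces.simps(5))
  qed
  then have "forces K w' B" using B by blast
  then have "forces K w' C" using BC w'(1,2) by simp
  then show False using C no_E I(3) by blast
qed

text \<open>The induction ranges over all of \<open>W\<^sub>b\<close>, since Mont applies its
  hypothesis at a base other than the given one.\<close>

lemma AR_sound_at_base:
  assumes K: "kripke_model At K" and sub: "W\<^sub>b \<subseteq> worlds K"
    and base: "\<And>w. w \<in> W\<^sub>b \<Longrightarrow> is_base par K w"
    and dense: "\<And>w' w. \<lbrakk>w' \<in> W\<^sub>b; w \<in> worlds K; preceq K w' w\<rbrakk> \<Longrightarrow>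
      \<exists>v\<in>W\<^sub>b. par_equiv par K v w \<and> preceq K w' v \<and> preceq K v w"
    and "AR var par A B" and "w \<in> W\<^sub>b" and "forces K w A"
  shows "forces K w B"
  using assms(5-7)
proof (induction arbitrary: w)
  case (AR_Ax A B)
  then show ?case using IPC_sound[OF K] sub preceq_refl by (metis forces.simps(5) subsetD)
next
  case (AR_V n m E F B C)
  have "\<exists>i\<in>{1..<n + m + 1}. forces K w (bracket par B (E i))"
  proof (rule base_forces_V[OF K])
    show "w \<in> worlds K" "is_base par K w" "forces K w (B \<^bold>\<rightarrow> C)"
      using AR_V sub base by auto
    show "forces K v B \<longleftrightarrow> (\<forall>i\<in>{1..<n + 1}. forces K v (E i \<^bold>\<rightarrow> F i))" for v
      unfolding AR_V(3) forces_big_and by (simp del: forces.simps upt_Suc)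
    show "forces K v C \<longleftrightarrow> (\<exists>i\<in>{n + 1..<n + m + 1}. forces K v (E i))" for v
      unfolding AR_V(4) forces_big_or by (simp del: upt_Suc)
  qed auto
  then show ?case unfolding forces_big_or by (simp del: upt_Suc)
next
  case (AR_Mont A B p)
  show ?case unfolding forces.simps(5)
  proof (intro ballI impI)
    fix v assume v: "v \<in> worlds K" "preceq K w v" "forces K v (Atom p)"
    \<comment> \<open>The node \<open>v\<close> need not be a base. The base \<open>b\<close>
      between \<open>w\<close> and \<open>v\<close> has the parameters of \<open>v\<close>, hence
      forces \<open>p\<close>, and being above \<open>w\<close> it forces \<open>A\<close>; what it
      forces persists to \<open>v\<close>.\<close>
    then obtain b where b: "b \<in> W\<^sub>b" "par_equiv par K b v" "preceq K w b" "preceq K b v"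
      using dense AR_Mont.prems by blast
    then have "forces K b (Atom p)" using v(3) AR_Mont.hyps(2) unfolding par_equiv_def by blast
    then have "forces K b A" using AR_Mont.prems(2) b sub by auto
    then have "forces K b B" using AR_Mont.IH b(1) by blast
    then show "forces K v B" using forces_mono[OF K] b sub v(1) by blast
  qed
qed auto

theorem theorem4p9:
  fixes var par :: "'a set" and A B :: "'a form" and K :: "('w, 'a) kripke"
  assumes "finite var" and "finite par" and "var \<inter> par = {}"
    and "AR var par A B"
    and "AR_model var par K"
    and "valid_in K A"
  shows "valid_in K B"
proof -
  from assms(5) have K: "kripke_model (var \<union> par) K"
    unfolding AR_model_def by blast
  from assms(5) obtain r W\<^sub>b where r: "r \<in> worlds K" "\<forall>w\<in>worlds K. preceq K r w" "r \<in> W\<^sub>b"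
    and W\<^sub>b: "W\<^sub>b \<subseteq> worlds K" "\<forall>w\<in>W\<^sub>b. is_base par K w"
      "\<forall>w'\<in>W\<^sub>b. \<forall>w\<in>worlds K. preceq K w' w \<longrightarrow>
         (\<exists>v\<in>W\<^sub>b. par_equiv par K v w \<and> preceq K w' v \<and> preceq K v w)"
    unfolding AR_model_def by blast
  \<comment> \<open>The root belongs to \<open>W\<^sub>b\<close>, and persistence spreads
    \<open>B\<close> from it to every node.\<close>
  have "forces K r B"
  proof (rule AR_sound_at_base[OF K W\<^sub>b(1)])
    show "AR var par A B" "r \<in> W\<^sub>b" by fact+
    show "forces K r A" using assms(6) r(1) by (simp add: valid_in_def)
  qed (use W\<^sub>b in blast)+
  then show ?thesis using forces_mono[OF K] r unfolding valid_in_def by blast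
qed

end
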